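(* Let $x=(x_n)_{n\in\mathbf{N}}$ be a sequence taking values in a metric space $X$, let $\mathcal{I}_\varphi$ be an analytic P-ideal on $\mathbf{N}$, where $\varphi$ is a lower semicontinuous submeasure with $\mathcal{I}_\varphi=\{A\subseteq \mathbf{N}: \|A\|_\varphi=0\}$. Then, for each real $q>0$, the set $$\Lambda_x(\mathcal{I}_\varphi,q):=\left\{\ell \in X: \lim_{n\to \infty,\, n \in A} x_{n} = \ell \text{ for some }A\subseteq \mathbf{N} \text{ such that }\|A\|_\varphi \ge q\right\}$$ is closed in $X$. In particular, the set $\Lambda_x(\mathcal{I}_\varphi)$ of $\mathcal{I}_\varphi$-limit points of $x$ is an $F_\sigma$-set.
   Context: $\mathbf{N}$ denotes the positive integers. An ideal on $\mathbf{N}$ is a family $\mathcal{I}\subseteq\mathcal{P}(\mathbf{N})$ closed under finite unions and subsets, which contains all finite subsets of $\mathbf{N}$ and is different from $\mathcal{P}(\mathbf{N})$. It is a P-ideal if for every sequence $(A_n)$ of sets in $\mathcal{I}$ there is $A\in\mathcal{I}$ with $A_n\setminus A$ finite for all $n$. It is analytic if, identifying $\mathcal{P}(\mathbf{N})$ with the Cantor space $\{0,1\}^{\mathbf{N}}$, it is a continuous image of a $G_\delta$-subset of the Cantor space. A lower semicontinuous submeasure is a map $\varphi:\mathcal{P}(\mathbf{N})\to[0,\infty]$ such that (i) $\varphi(\emptyset)=0$; (ii) $\varphi(\{n\})<\infty$ for all $n$; (iii) $\varphi(A)\le\varphi(B)$ whenever $A\subseteq B$; (iv) $\varphi(A\cup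 B)\le\varphi(A)+\varphi(B)$; (v) $\varphi(A)=\lim_n\varphi(A\cap\{1,\ldots,n\})$ for all $A$. Put $\|A\|_\varphi:=\lim_n\varphi(A\setminus\{1,\ldots,n\})$. By a classical theorem of Solecki, an ideal $\mathcal{I}$ is an analytic P-ideal if and only if $\mathcal{I}=\{A\subseteq\mathbf{N}:\|A\|_\varphi=0\}$ for some lower semicontinuous submeasure $\varphi$; an analytic P-ideal is written $\mathcal{I}_\varphi$ with $\varphi$ such an associated submeasure. For an ideal $\mathcal{I}$, a point $\ell\in X$ is an $\mathcal{I}$-limit point of $x$ if there is a subsequence $(x_{n_k})$ with $\lim_k x_{n_k}=\ell$ and $\{n_k:k\in\mathbf{N}\}\notin\mathcal{I}$; the set of these is $\Lambda_x(\mathcal{I})$. *)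

theory Defs
  imports "HOL-Analysis.Analysis"
begin

text \<open>The positive integers are the subset \<open>{1..}\<close> of \<^typ>\<open>nat\<close>: families of sets and
  submeasures are only ever constrained on subsets of \<open>{1..}\<close>, and the value \<open>x 0\<close> of a
  sequence is never used.\<close>

abbreviation Npos :: "nat set"
  where "Npos \<equiv> {1..}"

definition ideal_on_Npos :: "nat set set \<Rightarrow> bool" where
  "ideal_on_Npos I \<longleftrightarrow>
     I \<subseteq> Pow Npos \<and>
     (\<forall>A\<in>I. \<forall>B\<in>I. A \<union> B \<in> I) \<and>
     (\<forall>A\<in>I. \<forall>B. B \<subseteq> A \<longrightarrow> B \<in> I) \<and>
     (\<forall>A. A \<subseteq> Npos \<and> finite A \<longrightarrow> A \<in> I) \<and>
     I \<noteq> Pow Npos"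

definition P_ideal :: "nat set set \<Rightarrow> bool" where
  "P_ideal I \<longleftrightarrow> ideal_on_Npos I \<and>
     (\<forall>S :: nat \<Rightarrow> nat set. (\<forall>n. S n \<in> I) \<longrightarrow> (\<exists>A\<in>I. \<forall>n. finite (S n - A)))"

definition cantor_space :: "(nat \<Rightarrow> bool) topology" where
  "cantor_space = product_topology (\<lambda>_. discrete_topology UNIV) Npos"

text \<open>Points of a product topology are extensional functions, hence the \<^const>\<open>restrict\<close>.\<close>

definition char_fun :: "nat set \<Rightarrow> nat \<Rightarrow> bool" where
  "char_fun A = restrict (\<lambda>n. n \<in> A) Npos"

definition analytic_family :: "nat set set \<Rightarrow> bool" where
  "analytic_family I \<longleftrightarrow>
     (\<exists>G f. gdelta_in cantor_space G \<and>
            continuous_map (subtopology cantor_space G) cantor_space f \<and>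
            f ` G = char_fun ` I)"

definition lsc_submeasure :: "(nat set \<Rightarrow> ennreal) \<Rightarrow> bool" where
  "lsc_submeasure \<phi> \<longleftrightarrow>
     \<phi> {} = 0 \<and>
     (\<forall>n\<in>Npos. \<phi> {n} < \<infinity>) \<and>
     (\<forall>A B. A \<subseteq> B \<and> B \<subseteq> Npos \<longrightarrow> \<phi> A \<le> \<phi> B) \<and>
     (\<forall>A B. A \<subseteq> Npos \<and> B \<subseteq> Npos \<longrightarrow> \<phi> (A \<union> B) \<le> \<phi> A + \<phi> B) \<and>
     (\<forall>A. A \<subseteq> Npos \<longrightarrow> (\<lambda>n. \<phi> (A \<inter> {1..n})) \<longlonglongrightarrow> \<phi> A)"

text \<open>For a lower semicontinuous submeasure and \<open>A \<subseteq> {1..}\<close> this limit exists, the sequence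
  being decreasing.\<close>

definition submeasure_norm :: "(nat set \<Rightarrow> ennreal) \<Rightarrow> nat set \<Rightarrow> ennreal" where
  "submeasure_norm \<phi> A = lim (\<lambda>n. \<phi> (A - {1..n}))"

definition limit_points :: "(nat \<Rightarrow> 'a::metric_space) \<Rightarrow> nat set set \<Rightarrow> 'a set" where
  "limit_points x I =
     {l. \<exists>r. strict_mono r \<and> range r \<subseteq> Npos \<and> (x \<circ> r) \<longlonglongrightarrow> l \<and> range r \<notin> I}"

text \<open>The filter below expresses that \<open>n\<close> tends to infinity along \<open>A\<close>. It is trivial for
  finite \<open>A\<close>, but a finite set has norm \<open>0\<close> and is excluded when \<open>q > 0\<close>.\<close>

definition limit_points_ge ::
  "(nat \<Rightarrow> 'a::metric_space) \<Rightarrow> (nat set \<Rightarrow> ennreal) \<Rightarrow> real \<Rightarrow> 'a set" where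
  "limit_points_ge x \<phi> q =
     {l. \<exists>A. A \<subseteq> Npos \<and> (x \<longlongrightarrow> l) (inf sequentially (principal A)) \<and>
             submeasure_norm \<phi> A \<ge> ennreal q}"

end

theory Submission
  imports Defs
begin

text \<open>If \<open>l\<close> is a limit of points of \<open>\<Lambda>\<^sub>x(\<I>\<^sub>\<phi>, q)\<close>, then every set
  \<open>U\<^sub>k = {n. dist (x n) l < 1 / (k + 1)}\<close> almost contains a set of norm at least \<open>q\<close>, hence has
  norm at least \<open>q\<close> itself. By lower semicontinuity, consecutive finite blocks of the decreasing
  sets \<open>U\<^sub>k\<close> can be chosen with submeasures converging to \<open>q\<close>; along their union \<open>x\<close> tends
  to \<open>l\<close>, and every tail of the union contains almost all of the blocks.\<close>

lemma
  assumes "lsc_submeasure \<phi>"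
  shows lsc_submeasure_empty: "\<phi> {} = 0"
    and lsc_submeasure_mono: "\<And>A B. A \<subseteq> B \<Longrightarrow> B \<subseteq> Npos \<Longrightarrow> \<phi> A \<le> \<phi> B"
    and lsc_submeasure_tendsto: "\<And>A. A \<subseteq> Npos \<Longrightarrow> (\<lambda>n. \<phi> (A \<inter> {1..n})) \<longlonglongrightarrow> \<phi> A"
  using assms by (simp_all add: lsc_submeasure_def)

text \<open>The tails \<open>A - {1..n}\<close> shrink, so their submeasures decrease and the limit
  is an infimum. A lower bound on the norm thereby becomes a lower bound on every tail.\<close>

lemma submeasure_norm_eq_INF:
  assumes "lsc_submeasure \<phi>" "A \<subseteq> Npos"
  shows "submeasure_norm \<phi> A = (INF n. \<phi> (A - {1..n}))"
proof -
  have "decseq (\<lambda>n. \<phi> (A - {1..n}))"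
    unfolding decseq_def using assms by (auto intro!: lsc_submeasure_mono)
  then show ?thesis
    unfolding submeasure_norm_def by (intro limI LIMSEQ_INF)
qed

lemma le_submeasure_norm_iff:
  assumes "lsc_submeasure \<phi>" "A \<subseteq> Npos"
  shows "c \<le> submeasure_norm \<phi> A \<longleftrightarrow> (\<forall>n. c \<le> \<phi> (A - {1..n}))"
  using assms by (simp add: submeasure_norm_eq_INF le_INF_iff)

lemma submeasure_norm_finite:
  assumes "lsc_submeasure \<phi>" "A \<subseteq> Npos" "finite A"
  shows "submeasure_norm \<phi> A = 0"
proof -
  obtain n where "A \<subseteq> {..n}"
    using \<open>finite A\<close> finite_nat_iff_bounded_le by blast
  then have "A - {1..n} = {}"
    using \<open>A \<subseteq> Npos\<close> by auto
  then have "\<phi> (A - {1..n}) = 0"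
    by (simp only: lsc_submeasure_empty[OF assms(1)])
  moreover have "submeasure_norm \<phi> A \<le> \<phi> (A - {1..n})"
    using le_submeasure_norm_iff[OF assms(1,2)] by blast
  ultimately show ?thesis
    by simp
qed

text \<open>The norm ignores finite sets: once the cut passes the last point of
  \<open>A - B\<close>, what is left of \<open>A\<close> lies in the corresponding tail of
  \<open>B\<close>.\<close>

lemma submeasure_norm_almost_mono:
  assumes \<phi>: "lsc_submeasure \<phi>" and A: "A \<subseteq> Npos" and B: "B \<subseteq> Npos"
    and AB: "finite (A - B)"
  shows "submeasure_norm \<phi> A \<le> submeasure_norm \<phi> B"
  unfolding le_submeasure_norm_iff[OF \<phi> B]
proof
  fix n
  obtain N where N: "A - B \<subseteq> {..N}"
    using AB finite_nat_iff_bounded_le by blast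
  have "submeasure_norm \<phi> A \<le> \<phi> (A - {1..max n N})"
    using le_submeasure_norm_iff[OF \<phi> A] by blast
  also have "\<dots> \<le> \<phi> (B - {1..n})"
    using N A B by (intro lsc_submeasure_mono[OF \<phi>]) fastforce+
  finally show "submeasure_norm \<phi> A \<le> \<phi> (B - {1..n})" .
qed

text \<open>The tail of \<open>A\<close> beyond \<open>m\<close> has submeasure above
  \<open>c\<close>. By lower semicontinuity its finite initial segments approximate this value, so
  one of them already exceeds \<open>c\<close>.\<close>

lemma submeasure_block_exists:
  assumes \<phi>: "lsc_submeasure \<phi>" and A: "A \<subseteq> Npos" and c: "c < submeasure_norm \<phi> A"
  shows "\<exists>n>m. c < \<phi> (A \<inter> {m<..n})"
proof -
  have "c < \<phi> (A - {1..m})"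
    using c le_submeasure_norm_iff[OF \<phi> A, of "submeasure_norm \<phi> A"] by (auto intro: less_le_trans)
  moreover have "(\<lambda>n. \<phi> ((A - {1..m}) \<inter> {1..n})) \<longlonglongrightarrow> \<phi> (A - {1..m})"
    using A by (intro lsc_submeasure_tendsto[OF \<phi>]) auto
  ultimately have "\<forall>\<^sub>F n in sequentially. c < \<phi> ((A - {1..m}) \<inter> {1..n})"
    by (rule order_tendstoD(1)[rotated])
  then have "\<forall>\<^sub>F n in sequentially. n > m \<and> c < \<phi> ((A - {1..m}) \<inter> {1..n})"
    using eventually_gt_at_top by (rule eventually_conj[rotated])
  then obtain n where "n > m" "c < \<phi> ((A - {1..m}) \<inter> {1..n})"
    using eventually_happens'[OF sequentially_bot] by blast
  moreover have "(A - {1..m}) \<inter> {1..n} = A \<inter> {m<..n}"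
    using A by auto
  ultimately show ?thesis
    by auto
qed

lemma submeasure_norm_pseudo_intersection:
  fixes U :: "nat \<Rightarrow> nat set"
  assumes \<phi>: "lsc_submeasure \<phi>" and U: "\<And>k. U k \<subseteq> Npos" and dec: "decseq U"
    and q: "\<And>k. ennreal q \<le> submeasure_norm \<phi> (U k)" "q > 0"
  shows "\<exists>A\<subseteq>Npos. (\<forall>k. finite (A - U k)) \<and> ennreal q \<le> submeasure_norm \<phi> A"
proof -
  \<comment> \<open>The norm of \<open>U k\<close> may equal \<open>q\<close>, in which case finite
    blocks need not exceed \<open>q\<close>. The block from \<open>U k\<close> therefore only has to
    beat \<open>c k\<close>, which is nonnegative, strictly below \<open>q\<close> and tends to
    \<open>q\<close>.\<close>
  define c where "c k = q - q * inverse (real (Suc k))" for k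
  have "c k < q" for k
    using \<open>q > 0\<close> by (simp add: c_def)
  then have "ennreal (c k) < submeasure_norm \<phi> (U k)" for k
    using q by (meson ennreal_lessI less_le_trans)
  \<comment> \<open>The start \<open>m 0\<close> is arbitrary, so the invariant of the dependent
    choice is \<open>True\<close>; only the relation between consecutive cut points matters.\<close>
  then have "\<exists>m. \<forall>k. True \<and> m (Suc k) > m k \<and> ennreal (c k) < \<phi> (U k \<inter> {m k<..m (Suc k)})"
    using submeasure_block_exists[OF \<phi> U] by (intro dependent_nat_choice) auto
  then obtain m where m: "\<And>k. m k < m (Suc k)"
    and c: "\<And>k. ennreal (c k) < \<phi> (U k \<inter> {m k<..m (Suc k)})"
    by blast
  have mono: "strict_mono m"
    using m by (simp add: strict_mono_Suc_iff)
  define A where "A = (\<Union>k. U k \<inter> {m k<..m (Suc k)})"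
  have A: "A \<subseteq> Npos"
    using U by (auto simp: A_def)
  have "A - U k \<subseteq> {..m k}" for k
  proof
    fix n assume n: "n \<in> A - U k"
    then obtain j where j: "n \<in> U j" "n \<le> m (Suc j)"
      by (auto simp: A_def)
    \<comment> \<open>If k \<le> j, then \<open>U j\<close> would be contained in
      \<open>U k\<close>, which \<open>n\<close> avoids. So only the blocks before the k-th can
      leave \<open>U k\<close>.\<close>
    have "j < k"
      using j n decseqD[OF dec, of k j] by (meson DiffD2 not_less subsetD)
    then have "m (Suc j) \<le> m k"
      using mono by (simp add: strict_mono_less_eq)
    then show "n \<in> {..m k}"
      using j by simp
  qed
  then have "finite (A - U k)" for k
    by (rule finite_subset) simp
  moreover have "ennreal q \<le> \<phi> (A - {1..n})" for n
  proof (rule LIMSEQ_le_const2)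
    have "c \<longlonglongrightarrow> q - q * 0"
      unfolding c_def by (intro tendsto_intros LIMSEQ_inverse_real_of_nat)
    then show "(\<lambda>k. ennreal (c k)) \<longlonglongrightarrow> ennreal q"
      by (intro tendsto_ennrealI) simp
    \<comment> \<open>Strict monotonicity gives m k \<ge> k, so for k \<ge> n the k-th block lies
      entirely beyond \<open>n\<close>.\<close>
    have "ennreal (c k) \<le> \<phi> (A - {1..n})" if "k \<ge> n" for k
    proof -
      have "m k \<ge> n"
        using that strict_mono_imp_increasing[OF mono, of k] by simp
      then have "U k \<inter> {m k<..m (Suc k)} \<subseteq> A - {1..n}"
        by (auto simp: A_def)
      then have "\<phi> (U k \<inter> {m k<..m (Suc k)}) \<le> \<phi> (A - {1..n})"
        using A by (intro lsc_submeasure_mono[OF \<phi>]) auto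
      with c[of k] show ?thesis
        by simp
    qed
    then show "\<exists>N. \<forall>k\<ge>N. ennreal (c k) \<le> \<phi> (A - {1..n})"
      by blast
  qed
  ultimately show ?thesis
    using A le_submeasure_norm_iff[OF \<phi> A] by blast
qed

text \<open>On \<open>nat\<close>, eventually means for all but finitely many. Convergence along
  \<open>A\<close> thus becomes almost inclusion of \<open>A\<close> in every ball, the form that
  the pseudo-intersection provides.\<close>

lemma tendsto_along_set_iff:
  fixes x :: "nat \<Rightarrow> 'a::metric_space"
  shows "(x \<longlongrightarrow> l) (inf sequentially (principal A)) \<longleftrightarrow>
    (\<forall>e>0. finite (A - {n. dist (x n) l < e}))"
proof -
  have "(\<forall>\<^sub>F n in sequentially. n \<in> A \<longrightarrow> dist (x n) l < e) \<longleftrightarrow>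
      finite (A - {n. dist (x n) l < e})" for e
    by (simp flip: cofinite_eq_sequentially add: eventually_cofinite set_diff_eq)
  then show ?thesis
    by (simp add: tendsto_iff eventually_inf_principal)
qed

lemma closed_limit_points_ge:
  fixes x :: "nat \<Rightarrow> 'a::metric_space"
  assumes \<phi>: "lsc_submeasure \<phi>" and "q > 0"
  shows "closed (limit_points_ge x \<phi> q)"
proof -
  have "l \<in> limit_points_ge x \<phi> q" if l: "l \<in> closure (limit_points_ge x \<phi> q)" for l
  proof -
    define U where "U k = {n \<in> Npos. dist (x n) l < inverse (real (Suc k))}" for k
    have U: "U k \<subseteq> Npos" for k
      by (auto simp: U_def)
    have dec: "decseq U"
    proof (rule decseq_SucI)
      fix k
      have "inverse (real (Suc (Suc k))) \<le> inverse (real (Suc k))"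
        by (intro le_imp_inverse_le) simp_all
      then show "U (Suc k) \<subseteq> U k"
        unfolding U_def by (blast intro: order_less_le_trans)
    qed
    have "ennreal q \<le> submeasure_norm \<phi> (U k)" for k
    proof -
      \<comment> \<open>Half the radius of the ball defining \<open>U k\<close>: by the triangle
        inequality, the ball of radius \<open>e\<close> around \<open>l'\<close> lies inside the
        ball around \<open>l\<close>.\<close>
      define e where "e = inverse (real (Suc k)) / 2"
      have "e > 0"
        by (simp add: e_def)
      then obtain l' where "l' \<in> limit_points_ge x \<phi> q" and l': "dist l' l < e"
        using l by (auto simp: closure_approachable)
      then obtain A where A: "A \<subseteq> Npos" "ennreal q \<le> submeasure_norm \<phi> A"
        and fin: "finite (A - {n. dist (x n) l' < e})"
        using \<open>e > 0\<close> by (auto simp: limit_points_ge_def tendsto_along_set_iff)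
      have "dist (x n) l < inverse (real (Suc k))" if "dist (x n) l' < e" for n
        using dist_triangle[of "x n" l l'] that l' by (simp add: e_def)
      then have "A - U k \<subseteq> A - {n. dist (x n) l' < e}"
        using A by (auto simp: U_def)
      then show ?thesis
        using submeasure_norm_almost_mono[OF \<phi> A(1) U] A(2) fin
        by (meson finite_subset order_trans)
    qed
    then obtain A where A: "A \<subseteq> Npos" "ennreal q \<le> submeasure_norm \<phi> A"
      and fin: "\<And>k. finite (A - U k)"
      using submeasure_norm_pseudo_intersection[OF \<phi> U dec _ \<open>q > 0\<close>] by metis
    have "finite (A - {n. dist (x n) l < e})" if "e > 0" for e
    proof -
      obtain k where "inverse (real (Suc k)) < e"
        using reals_Archimedean[OF \<open>e > 0\<close>] by blast
      then have "A - {n. dist (x n) l < e} \<subseteq> A - U k"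
        by (auto simp: U_def)
      then show ?thesis
        using fin finite_subset by blast
    qed
    with A show ?thesis
      by (auto simp: limit_points_ge_def tendsto_along_set_iff)
  qed
  then show ?thesis
    using closure_subset_eq by blast
qed

text \<open>Since \<open>r\<close> is injective, finitely many exceptional values in
  \<open>range r\<close> amount to finitely many exceptional indices. This links subsequences with
  convergence along sets.\<close>

lemma tendsto_range_iff:
  fixes x :: "nat \<Rightarrow> 'a::metric_space" and r :: "nat \<Rightarrow> nat"
  assumes "strict_mono r"
  shows "(x \<longlongrightarrow> l) (inf sequentially (principal (range r))) \<longleftrightarrow> (x \<circ> r) \<longlonglongrightarrow> l"
proof -
  have "finite (range r - {n. dist (x n) l < e}) \<longleftrightarrow>
      finite (UNIV - {k. dist ((x \<circ> r) k) l < e})" for e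
  proof -
    have "range r - {n. dist (x n) l < e} = r ` (UNIV - {k. dist ((x \<circ> r) k) l < e})"
      by auto
    moreover have "inj_on r B" for B
      using assms strict_mono_imp_inj_on inj_on_subset by blast
    ultimately show ?thesis
      by (simp add: finite_image_iff)
  qed
  then show ?thesis
    using tendsto_along_set_iff[of "x \<circ> r" l UNIV] by (simp add: tendsto_along_set_iff)
qed

lemma limit_points_eq_Union:
  fixes x :: "nat \<Rightarrow> 'a::metric_space"
  assumes \<phi>: "lsc_submeasure \<phi>"
  shows "limit_points x {A. A \<subseteq> Npos \<and> submeasure_norm \<phi> A = 0} =
    (\<Union>k. limit_points_ge x \<phi> (inverse (real (Suc k))))"
    (is "?L = ?R")
proof (intro set_eqI iffI)
  fix l assume "l \<in> ?L"
  then obtain r where r: "strict_mono r" "range r \<subseteq> Npos" "(x \<circ> r) \<longlonglongrightarrow> l"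
    and pos: "submeasure_norm \<phi> (range r) \<noteq> 0"
    by (auto simp: limit_points_def)
  \<comment> \<open>A norm below all these reciprocals would be at most their limit 0.\<close>
  have "\<exists>k. ennreal (inverse (real (Suc k))) \<le> submeasure_norm \<phi> (range r)"
  proof (rule ccontr)
    assume "\<not> ?thesis"
    then have "submeasure_norm \<phi> (range r) \<le> ennreal (inverse (real (Suc k)))" for k
      by (meson linear)
    moreover have "(\<lambda>k. ennreal (inverse (real (Suc k)))) \<longlonglongrightarrow> ennreal 0"
      by (intro tendsto_ennrealI LIMSEQ_inverse_real_of_nat)
    ultimately have "submeasure_norm \<phi> (range r) \<le> ennreal 0"
      using LIMSEQ_le_const by blast
    with pos show False
      by simp
  qed
  then show "l \<in> ?R"
    using r tendsto_range_iff[OF r(1), of x l] unfolding limit_points_ge_def by blast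
next
  fix l assume "l \<in> ?R"
  then obtain k A where A: "A \<subseteq> Npos" "(x \<longlongrightarrow> l) (inf sequentially (principal A))"
    and le: "ennreal (inverse (real (Suc k))) \<le> submeasure_norm \<phi> A"
    by (auto simp: limit_points_ge_def)
  have "0 < ennreal (inverse (real (Suc k)))"
    by simp
  then have pos: "submeasure_norm \<phi> A \<noteq> 0"
    using le by (metis not_less)
  \<comment> \<open>Finite sets have norm 0. An infinite \<open>A\<close> has an increasing
    enumeration, which is the required subsequence.\<close>
  then have "infinite A"
    using submeasure_norm_finite[OF \<phi>] A by blast
  then have r: "strict_mono (enumerate A)" "range (enumerate A) = A"
    by (simp_all add: strict_mono_enumerate range_enumerate)
  then have "(x \<circ> enumerate A) \<longlonglongrightarrow> l"
    using A(2) tendsto_range_iff[OF r(1), of x l] by (simp only: r(2))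
  then show "l \<in> ?L"
    unfolding limit_points_def using r A(1) pos
    by (intro CollectI exI[of _ "enumerate A"]) simp
qed

theorem theorem3p1:
  fixes x :: "nat \<Rightarrow> 'a::metric_space"
    and I :: "nat set set"
    and \<phi> :: "nat set \<Rightarrow> ennreal"
  assumes "P_ideal I"
    and "analytic_family I"
    and "lsc_submeasure \<phi>"
    and "I = {A. A \<subseteq> Npos \<and> submeasure_norm \<phi> A = 0}"
  shows "(\<forall>q::real. q > 0 \<longrightarrow> closed (limit_points_ge x \<phi> q)) \<and> fsigma (limit_points x I)"
proof
  show "\<forall>q::real. q > 0 \<longrightarrow> closed (limit_points_ge x \<phi> q)"
    using closed_limit_points_ge[OF assms(3)] by blast
  \<comment> \<open>The union is countable, and each of its members is closed because its threshold
    is positive.\<close>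
  then show "fsigma (limit_points x I)"
    unfolding assms(4) limit_points_eq_Union[OF assms(3)] by (intro fsigma.intros) simp
qed

end
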